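(* Let $(Y,\mathbf{X})$ be a $(d+1)$-dimensional random vector such that the distribution function $F_Y$ of $Y$ is continuous. Then the function $\kappa_{(Y,\mathbf{X})}$ maps $[0,1]$ into $[0,1]$ and is convex, non-increasing, and Lipschitz continuous with Lipschitz constant $3$.
   Context: $Y$ is real-valued and $\mathbf{X}$ takes values in $\mathbb{R}^d$, $d\ge 1$. $Y'$ is a random variable (on a possibly extended probability space) such that, conditionally on $\mathbf{X}$, $Y$ and $Y'$ are independent and identically distributed, i.e. $\mathbb{P}(Y\in A, Y'\in B\mid \mathbf{X})=\mathbb{P}(Y\in A\mid\mathbf{X})\,\mathbb{P}(Y\in B\mid\mathbf{X})$ almost surely for all Borel sets $A,B\subseteq\mathbb{R}$. For $t\in[0,1]$, $$\phi_{(Y,\mathbf{X})}(t):=\mathbb{P}\bigl(|F_Y(Y)-F_Y(Y')|\le t\bigr),\qquad \kappa_{(Y,\mathbf{X})}(t):=1-3\int_0^t\bigl(1-\phi_{(Y,\mathbf{X})}(s)\bigr)\,\mathrm{d}s.$$ *)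

theory Defs
  imports "HOL-Probability.Probability"
begin

text \<open>
  The probability of the event \<open>E\<close> given the random vector \<open>X\<close>, as a (version of a) random
  variable on \<open>M\<close>; \<open>vimage_algebra (space M) X borel\<close> is the sigma-algebra generated by \<open>X\<close>.
\<close>

definition prob_given ::
  "'a measure \<Rightarrow> ('a \<Rightarrow> 'x::topological_space) \<Rightarrow> 'a set \<Rightarrow> 'a \<Rightarrow> real" where
  "prob_given M X E = real_cond_exp M (vimage_algebra (space M) X borel) (indicator E)"

text \<open>
  \<open>N\<close> extends the probability space \<open>M\<close>: random variables on \<open>M\<close> are regarded as random
  variables on \<open>N\<close> by composition with the measure-preserving map \<open>p\<close>. The case \<open>N = M\<close>
  and \<open>p = id\<close> (no extension) is included.
\<close>

definition prob_extension :: "'a measure \<Rightarrow> 'b measure \<Rightarrow> ('b \<Rightarrow> 'a) \<Rightarrow> bool" where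
  "prob_extension M N p \<longleftrightarrow> prob_space N \<and> p \<in> N \<rightarrow>\<^sub>M M \<and> distr N M p = M"

text \<open>
  On the right-hand side of the product formula both factors are conditional probabilities of
  \<open>Y\<close>, so the formula expresses conditional independence (of \<open>Y\<close> and \<open>Y'\<close> given \<open>X\<close>) and
  equality of the conditional distributions at once.
\<close>

definition cond_iid_copy ::
  "'a measure \<Rightarrow> ('a \<Rightarrow> real) \<Rightarrow> ('a \<Rightarrow> real ^ 'd) \<Rightarrow> 'b measure \<Rightarrow> ('b \<Rightarrow> 'a) \<Rightarrow> ('b \<Rightarrow> real) \<Rightarrow> bool"
  where
  "cond_iid_copy M Y X N p Y' \<longleftrightarrow>
     prob_extension M N p \<and> Y' \<in> borel_measurable N \<and>
     (\<forall>A\<in>sets borel. \<forall>B\<in>sets borel. AE \<omega> in N.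
        prob_given N (X \<circ> p) {\<omega> \<in> space N. Y (p \<omega>) \<in> A \<and> Y' \<omega> \<in> B} \<omega> =
        prob_given N (X \<circ> p) {\<omega> \<in> space N. Y (p \<omega>) \<in> A} \<omega> *
        prob_given N (X \<circ> p) {\<omega> \<in> space N. Y (p \<omega>) \<in> B} \<omega>)"

definition dist_fun :: "'a measure \<Rightarrow> ('a \<Rightarrow> real) \<Rightarrow> real \<Rightarrow> real" where
  "dist_fun M Y = cdf (distr M borel Y)"

text \<open>
  The vector \<open>X\<close> enters \<open>\<phi>\<close> and \<open>\<kappa>\<close> only through the conditional copy \<open>Y'\<close> of \<open>Y\<close> given \<open>X\<close>,
  so \<open>Y'\<close> takes its place as a parameter.
\<close>

definition phi ::
  "'a measure \<Rightarrow> ('a \<Rightarrow> real) \<Rightarrow> 'b measure \<Rightarrow> ('b \<Rightarrow> 'a) \<Rightarrow> ('b \<Rightarrow> real) \<Rightarrow> real \<Rightarrow> real" where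
  "phi M Y N p Y' t =
     measure N {\<omega> \<in> space N. \<bar>dist_fun M Y (Y (p \<omega>)) - dist_fun M Y (Y' \<omega>)\<bar> \<le> t}"

definition kappa ::
  "'a measure \<Rightarrow> ('a \<Rightarrow> real) \<Rightarrow> 'b measure \<Rightarrow> ('b \<Rightarrow> 'a) \<Rightarrow> ('b \<Rightarrow> real) \<Rightarrow> real \<Rightarrow> real" where
  "kappa M Y N p Y' t = 1 - 3 * integral {0..t} (\<lambda>s. 1 - phi M Y N p Y' s)"

end

theory Submission imports Defs begin

text \<open>
  Write \<open>U = F\<^sub>Y(Y)\<close>, \<open>U' = F\<^sub>Y(Y')\<close> and \<open>D = \<bar>U - U'\<bar>\<close>. The integrand in the definition of \<open>\<kappa>\<close>
  is the tail probability \<open>P(D > s)\<close>, so Tonelli's theorem gives \<open>\<kappa>(t) = 1 - 3 E(min(D, t))\<close>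
  (lemma \<open>integral_tail_eq_expectation_min\<close>). For each fixed value of \<open>D\<close> the function
  \<open>t \<mapsto> min(D, t)\<close> is concave, non-decreasing, 1-Lipschitz and non-negative on \<open>[0,1]\<close>, and all
  of this survives taking expectations. Everything except \<open>\<kappa> \<ge> 0\<close> follows.

  For \<open>\<kappa> \<ge> 0\<close> one needs \<open>E(D) \<le> 1/3\<close>. The distance of \<open>U\<close> and \<open>U'\<close> is the length of the set of
  levels \<open>s\<close> that separate them, so Tonelli's theorem turns \<open>E(D)\<close> into the integral over \<open>s\<close> of the
  probability that \<open>s\<close> separates \<open>U\<close> and \<open>U'\<close> (lemma \<open>expectation_abs_diff_le\<close>). Given \<open>X\<close>, each of
  \<open>U \<le> s < U'\<close> and \<open>U' \<le> s < U\<close> has probability \<open>q (1 - q)\<close> with \<open>q = P(U \<le> s | X)\<close>. As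
  \<open>q \<mapsto> q (1 - q)\<close> is concave, Jensen's inequality bounds the mean of this by \<open>c (1 - c)\<close> with
  \<open>c = E(q) = P(U \<le> s)\<close> (lemma \<open>prob_le_of_cond_product_compl\<close>). Continuity of \<open>F\<^sub>Y\<close> makes \<open>U\<close>
  uniformly distributed on \<open>[0,1]\<close>, so \<open>c = s\<close> (lemma \<open>measure_cdf_le_eq\<close>), and the integral
  of \<open>2 s (1 - s)\<close> over \<open>[0,1]\<close> is \<open>1/3\<close>.
\<close>

section \<open>Tail integrals and separating levels\<close>

text \<open>
  For fixed \<open>\<omega>\<close>, the number \<open>min (D \<omega>) t\<close> is the length of \<open>{s \<in> [0,t]. s < D \<omega>}\<close>; exchanging
  the order of integration turns its mean into the integral of \<open>P(D > s)\<close> over \<open>[0,t]\<close>.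
\<close>

lemma integral_tail_eq_expectation_min:
  assumes "prob_space N" and D[measurable]: "D \<in> borel_measurable N"
    and D0: "\<And>\<omega>. 0 \<le> D \<omega>" and t: "0 \<le> (t::real)"
  shows "integral {0..t} (\<lambda>s. 1 - measure N {\<omega> \<in> space N. D \<omega> \<le> s}) = (\<integral>\<omega>. min (D \<omega>) t \<partial>N)"
proof -
  interpret prob_space N by fact
  interpret pair_sigma_finite N lborel ..
  let ?g = "\<lambda>s. 1 - measure N {\<omega> \<in> space N. D \<omega> \<le> s}"
  have g: "?g s = measure N {\<omega> \<in> space N. s < D \<omega>}" for s
  proof -
    have "{\<omega> \<in> space N. s < D \<omega>} = space N - {\<omega> \<in> space N. D \<omega> \<le> s}" by auto
    then show ?thesis by (simp add: prob_compl)
  qed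
  let ?J = "\<lambda>\<omega> s. indicator {0..t} s * (indicator {..<D \<omega>} s :: ennreal)"
  have length: "(\<integral>\<^sup>+s. ?J \<omega> s \<partial>lborel) = ennreal (min (D \<omega>) t)" for \<omega>
  proof -
    have "(\<integral>\<^sup>+s. ?J \<omega> s \<partial>lborel) = emeasure lborel ({0..t} \<inter> {..<D \<omega>})"
      by (simp add: indicator_inter_arith[symmetric])
    also have "\<dots> = ennreal (min (D \<omega>) t)"
    proof (cases "D \<omega> \<le> t")
      case True
      then have "{0..t} \<inter> {..<D \<omega>} = {0..<D \<omega>}" by auto
      then show ?thesis using True D0 by (simp add: min_def)
    next
      case False
      then have "{0..t} \<inter> {..<D \<omega>} = {0..t}" by auto
      then show ?thesis using False t by (simp add: min_def)
    qed
    finally show ?thesis .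
  qed
  have J_meas: "case_prod ?J \<in> borel_measurable (N \<Otimes>\<^sub>M lborel)"
  proof -
    have "(\<lambda>(\<omega>,s). ?J \<omega> s) = (\<lambda>x. if 0 \<le> snd x \<and> snd x \<le> t \<and> snd x < D (fst x) then 1 else 0)"
      by (auto simp: indicator_def fun_eq_iff)
    then show ?thesis by simp
  qed
  have inner: "(\<integral>\<^sup>+\<omega>. ?J \<omega> s \<partial>N) = ennreal (indicator {0..t} s * ?g s)" for s
  proof -
    have "(\<integral>\<^sup>+\<omega>. ?J \<omega> s \<partial>N)
        = (\<integral>\<^sup>+\<omega>. indicator {0..t} s * indicator {\<omega> \<in> space N. s < D \<omega>} \<omega> \<partial>N)"
      by (intro nn_integral_cong) (auto simp: indicator_def)
    also have "\<dots> = indicator {0..t} s * emeasure N {\<omega> \<in> space N. s < D \<omega>}"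
      by (simp add: nn_integral_cmult)
    also have "\<dots> = ennreal (indicator {0..t} s * ?g s)"
      unfolding g by (simp add: emeasure_eq_measure indicator_def)
    finally show ?thesis .
  qed
  have int: "integrable N (\<lambda>\<omega>. min (D \<omega>) t)"
    using D0 t by (intro integrable_const_bound[where B=t]) (auto intro!: AE_I2)
  have "(\<integral>\<^sup>+s. ennreal (indicator {0..t} s * ?g s) \<partial>lborel) = (\<integral>\<^sup>+s. \<integral>\<^sup>+\<omega>. ?J \<omega> s \<partial>N \<partial>lborel)"
    by (simp only: inner)
  also have "\<dots> = (\<integral>\<^sup>+\<omega>. \<integral>\<^sup>+s. ?J \<omega> s \<partial>lborel \<partial>N)"
    by (rule Fubini'[OF J_meas])
  also have "\<dots> = (\<integral>\<^sup>+\<omega>. ennreal (min (D \<omega>) t) \<partial>N)"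
    by (simp only: length)
  also have "\<dots> = ennreal (\<integral>\<omega>. min (D \<omega>) t \<partial>N)"
    using D0 t by (intro nn_integral_eq_integral[OF int]) auto
  finally have nn: "(\<integral>\<^sup>+s. ennreal (indicator {0..t} s * ?g s) \<partial>lborel) = ennreal (\<integral>\<omega>. min (D \<omega>) t \<partial>N)" .
  have "mono (\<lambda>s. measure N {\<omega> \<in> space N. D \<omega> \<le> s})"
    by (intro monoI finite_measure_mono) auto
  then have [measurable]: "?g \<in> borel_measurable borel"
    by (intro borel_measurable_diff borel_measurable_mono) auto
  have "((\<lambda>s. indicator {0..t} s * ?g s) has_integral (\<integral>\<omega>. min (D \<omega>) t \<partial>N)) UNIV"
    using D0 t by (intro nn_integral_has_integral[OF _ _ nn]) (auto intro!: integral_nonneg_AE)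
  then have "((\<lambda>s. if s \<in> {0..t} then ?g s else 0) has_integral (\<integral>\<omega>. min (D \<omega>) t \<partial>N)) UNIV"
    by (rule has_integral_eq[rotated]) (auto simp: indicator_def)
  then have "(?g has_integral (\<integral>\<omega>. min (D \<omega>) t \<partial>N)) {0..t}"
    by (simp only: has_integral_restrict_UNIV)
  then show ?thesis by (rule integral_unique)
qed

text \<open>
  The length \<open>\<bar>U - V\<bar>\<close> of the interval between \<open>U\<close> and \<open>V\<close> is the integral over \<open>s\<close> of the
  indicator of \<open>s\<close> lying in it. By Tonelli's theorem its mean is an integral of probabilities, at
  most \<open>2 s (1 - s)\<close> each. Taking the interval open confines \<open>s\<close> to \<open>(0,1)\<close>.
\<close>

lemma expectation_abs_diff_le:
  assumes "prob_space N" and [measurable]: "U \<in> borel_measurable N" "V \<in> borel_measurable N"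
    and U: "\<And>\<omega>. U \<omega> \<in> {0..1::real}" and V: "\<And>\<omega>. V \<omega> \<in> {0..1}"
    and sep: "\<And>s. 0 < s \<Longrightarrow> s < 1 \<Longrightarrow>
      measure N {\<omega> \<in> space N. U \<omega> \<le> s \<and> s < V \<omega>} \<le> s * (1 - s) \<and>
      measure N {\<omega> \<in> space N. V \<omega> \<le> s \<and> s < U \<omega>} \<le> s * (1 - s)"
  shows "(\<integral>\<omega>. \<bar>U \<omega> - V \<omega>\<bar> \<partial>N) \<le> 1/3"
proof -
  interpret prob_space N by fact
  interpret pair_sigma_finite N lborel ..
  let ?S = "\<lambda>\<omega> s. min (U \<omega>) (V \<omega>) < s \<and> s < max (U \<omega>) (V \<omega>)"
  let ?J = "\<lambda>\<omega> s. (if ?S \<omega> s then 1 else 0) :: ennreal"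
  have J_meas: "case_prod ?J \<in> borel_measurable (N \<Otimes>\<^sub>M lborel)"
    by measurable
  have length: "(\<integral>\<^sup>+s. ?J \<omega> s \<partial>lborel) = ennreal \<bar>U \<omega> - V \<omega>\<bar>" for \<omega>
  proof -
    have "(\<integral>\<^sup>+s. ?J \<omega> s \<partial>lborel) = (\<integral>\<^sup>+s. indicator {min (U \<omega>) (V \<omega>)<..<max (U \<omega>) (V \<omega>)} s \<partial>lborel)"
      by (intro nn_integral_cong) (auto simp: indicator_def)
    also have "\<dots> = ennreal (max (U \<omega>) (V \<omega>) - min (U \<omega>) (V \<omega>))"
      by (subst nn_integral_indicator) auto
    also have "max (U \<omega>) (V \<omega>) - min (U \<omega>) (V \<omega>) = \<bar>U \<omega> - V \<omega>\<bar>" by auto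
    finally show ?thesis .
  qed
  have inner: "(\<integral>\<^sup>+\<omega>. ?J \<omega> s \<partial>N) \<le> ennreal (2 * s * (1 - s)) * indicator {0..1} s" for s
  proof (cases "0 < s \<and> s < 1")
    case True
    have "(\<integral>\<^sup>+\<omega>. ?J \<omega> s \<partial>N) = (\<integral>\<^sup>+\<omega>. indicator {\<omega> \<in> space N. ?S \<omega> s} \<omega> \<partial>N)"
      by (intro nn_integral_cong) (auto simp: indicator_def)
    also have "\<dots> = ennreal (measure N {\<omega> \<in> space N. ?S \<omega> s})"
      by (subst nn_integral_indicator) (auto simp: emeasure_eq_measure)
    also have "measure N {\<omega> \<in> space N. ?S \<omega> s}
        \<le> measure N ({\<omega> \<in> space N. U \<omega> \<le> s \<and> s < V \<omega>} \<union> {\<omega> \<in> space N. V \<omega> \<le> s \<and> s < U \<omega>})"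
      by (intro finite_measure_mono) auto
    also have "\<dots> \<le> measure N {\<omega> \<in> space N. U \<omega> \<le> s \<and> s < V \<omega>}
        + measure N {\<omega> \<in> space N. V \<omega> \<le> s \<and> s < U \<omega>}"
      by (intro measure_Un_le) auto
    also have "\<dots> \<le> 2 * s * (1 - s)"
      using sep[of s] True by (simp add: algebra_simps)
    finally show ?thesis using True by (simp add: ennreal_leI)
  next
    case False
    then have "\<not> ?S \<omega> s" for \<omega>
      using U[of \<omega>] V[of \<omega>] by auto
    then have "?J \<omega> s = 0" for \<omega> by (simp only: if_False)
    then show ?thesis by simp
  qed
  have int: "integrable N (\<lambda>\<omega>. \<bar>U \<omega> - V \<omega>\<bar>)"
  proof (intro integrable_const_bound[where B=1] AE_I2)
    show "norm \<bar>U \<omega> - V \<omega>\<bar> \<le> 1" for \<omega> using U[of \<omega>] V[of \<omega>] by auto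
  qed measurable
  have "ennreal (\<integral>\<omega>. \<bar>U \<omega> - V \<omega>\<bar> \<partial>N) = (\<integral>\<^sup>+\<omega>. ennreal \<bar>U \<omega> - V \<omega>\<bar> \<partial>N)"
    by (rule nn_integral_eq_integral[symmetric, OF int]) auto
  also have "\<dots> = (\<integral>\<^sup>+\<omega>. \<integral>\<^sup>+s. ?J \<omega> s \<partial>lborel \<partial>N)"
    by (simp only: length)
  also have "\<dots> = (\<integral>\<^sup>+s. \<integral>\<^sup>+\<omega>. ?J \<omega> s \<partial>N \<partial>lborel)"
    by (rule Fubini'[OF J_meas, symmetric])
  also have "\<dots> \<le> (\<integral>\<^sup>+s. ennreal (2 * s * (1 - s)) * indicator {0..1} s \<partial>lborel)"
    by (intro nn_integral_mono inner)
  also have "\<dots> = ennreal ((1\<^sup>2 - 2/3 * 1^3) - (0\<^sup>2 - 2/3 * 0^3))"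
    by (intro nn_integral_FTC_Icc[where F="\<lambda>s. s\<^sup>2 - 2/3 * s^3"])
       (auto intro!: derivative_eq_intros simp: algebra_simps power2_eq_square mult_left_le)
  finally show ?thesis by simp
qed

section \<open>Uniform distribution of the probability transform\<close>

text \<open>
  The intermediate value theorem makes the set of points with \<open>cdf \<mu> x = s\<close> non-empty, and the
  limits of the distribution function at infinity make it bounded above. Its largest element \<open>y\<close>
  satisfies \<open>cdf \<mu> x \<le> s \<longleftrightarrow> x \<le> y\<close>, so the set in question is a half-line of measure
  \<open>cdf \<mu> y = s\<close>.
\<close>

lemma measure_cdf_le_eq:
  assumes "real_distribution \<mu>" and cont: "continuous_on UNIV (cdf \<mu>)" and s: "0 < s" "s < 1"
  shows "measure \<mu> {x. cdf \<mu> x \<le> s} = s"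
proof -
  interpret real_distribution \<mu> by fact
  have "eventually (\<lambda>x. cdf \<mu> x < s) at_bot"
    using order_tendstoD(2)[OF cdf_lim_at_bot] s by blast
  then obtain a where a: "cdf \<mu> a < s" by (auto simp: eventually_at_bot_linorder)
  have "eventually (\<lambda>x. s < cdf \<mu> x) at_top"
    using order_tendstoD(1)[OF cdf_lim_at_top_prob] s by blast
  then obtain b where b: "s < cdf \<mu> b" by (auto simp: eventually_at_top_linorder)
  have ab: "a \<le> b" using a b cdf_nondecreasing[of b a] by linarith
  let ?Z = "{x. cdf \<mu> x = s}"
  have "\<exists>x\<ge>a. x \<le> b \<and> cdf \<mu> x = s"
    using a b ab by (intro IVT') (auto intro: continuous_on_subset[OF cont])
  then have ne: "?Z \<noteq> {}" by auto
  have le_b: "x \<le> b" if "x \<in> ?Z" for x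
    using that b cdf_nondecreasing[of b x] by force
  then have bdd: "bdd_above ?Z" by (intro bdd_aboveI)
  have "closed ?Z"
    using continuous_closed_preimage_constant[OF cont] by simp
  then have "Sup ?Z \<in> ?Z" by (intro closed_contains_Sup ne bdd)
  then have y: "cdf \<mu> (Sup ?Z) = s" by simp
  have "cdf \<mu> x \<le> s \<longleftrightarrow> x \<le> Sup ?Z" for x
  proof
    assume le: "cdf \<mu> x \<le> s"
    show "x \<le> Sup ?Z"
    proof (rule ccontr)
      assume "\<not> x \<le> Sup ?Z"
      then have "cdf \<mu> x = s" using cdf_nondecreasing[of "Sup ?Z" x] y le by simp
      then have "x \<le> Sup ?Z" by (intro cSup_upper bdd) simp
      with \<open>\<not> x \<le> Sup ?Z\<close> show False by simp
    qed
  next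
    assume "x \<le> Sup ?Z" then show "cdf \<mu> x \<le> s" using cdf_nondecreasing y by metis
  qed
  then have "{x. cdf \<mu> x \<le> s} = {..Sup ?Z}" by auto
  then show ?thesis using y by (simp add: cdf_def2)
qed

section \<open>Conditional independence and Jensen's inequality\<close>

text \<open>
  With \<open>q\<close> the conditional probability of \<open>E\<close> and \<open>c\<close> its mean \<open>P(E)\<close>, the conditional
  probability of \<open>J\<close> is \<open>q (1 - q)\<close>, which lies below its tangent at \<open>c\<close>: indeed
  \<open>q (1 - q) \<le> (1 - 2 c) q + c\<^sup>2\<close>. Taking means gives the bound. Using the tangent rather than
  \<open>q\<^sup>2\<close> keeps the majorant affine in \<open>q\<close>, hence integrable because \<open>q\<close> is.
\<close>

lemma prob_le_of_cond_product_compl: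
  fixes W :: "'b \<Rightarrow> 'x::topological_space"
  assumes "prob_space N" and W: "W \<in> borel_measurable N"
    and E[measurable]: "E \<in> sets N" and J[measurable]: "J \<in> sets N"
    and prod: "AE \<omega> in N. prob_given N W J \<omega> = prob_given N W E \<omega> * prob_given N W (space N - E) \<omega>"
  shows "measure N J \<le> measure N E * (1 - measure N E)"
proof -
  interpret prob_space N by fact
  let ?F = "vimage_algebra (space N) W borel"
  have "subalgebra N ?F"
    using measurable_sets[OF W] by (auto simp: subalgebra_def sets_vimage_algebra2)
  then interpret finite_measure_subalgebra N ?F
    by unfold_locales
  have int: "integrable N (prob_given N W A)" "(\<integral>\<omega>. prob_given N W A \<omega> \<partial>N) = measure N A"
    if [measurable]: "A \<in> sets N" for A
  proof -
    have "integrable N (indicator A :: _ \<Rightarrow> real)"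
      by (simp add: integrable_indicator_iff emeasure_eq_measure)
    from real_cond_exp_int[OF this]
    show "integrable N (prob_given N W A)" "(\<integral>\<omega>. prob_given N W A \<omega> \<partial>N) = measure N A"
      by (simp_all add: prob_given_def)
  qed
  have "AE \<omega> in N. real_cond_exp N ?F (\<lambda>\<omega>. indicator E \<omega> + indicator (space N - E) \<omega>) \<omega>
      = prob_given N W E \<omega> + prob_given N W (space N - E) \<omega>"
    unfolding prob_given_def
    by (intro real_cond_exp_add) (simp_all add: integrable_indicator_iff emeasure_eq_measure)
  moreover have "AE \<omega> in N. real_cond_exp N ?F (\<lambda>\<omega>. indicator E \<omega> + indicator (space N - E) \<omega>) \<omega>
      = real_cond_exp N ?F (\<lambda>\<omega>. 1) \<omega>"
    by (intro real_cond_exp_cong) (auto simp: indicator_def intro!: AE_I2)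
  moreover have "AE \<omega> in N. real_cond_exp N ?F (\<lambda>\<omega>. 1) \<omega> = 1"
    by (intro real_cond_exp_F_meas) auto
  ultimately have compl: "AE \<omega> in N. prob_given N W (space N - E) \<omega> = 1 - prob_given N W E \<omega>"
    by eventually_elim simp
  let ?c = "measure N E"
  have "AE \<omega> in N. prob_given N W J \<omega> \<le> (1 - 2 * ?c) * prob_given N W E \<omega> + ?c\<^sup>2"
    using prod compl
  proof eventually_elim
    case (elim \<omega>)
    have "0 \<le> (prob_given N W E \<omega> - ?c)\<^sup>2" by simp
    then show ?case unfolding elim by (simp add: power2_eq_square algebra_simps)
  qed
  then have "(\<integral>\<omega>. prob_given N W J \<omega> \<partial>N) \<le> (\<integral>\<omega>. (1 - 2 * ?c) * prob_given N W E \<omega> + ?c\<^sup>2 \<partial>N)"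
    by (intro integral_mono_AE Bochner_Integration.integrable_add integrable_mult_right int) simp_all
  also have "\<dots> = (1 - 2 * ?c) * ?c + ?c\<^sup>2"
    using int[OF E] by (simp add: prob_space)
  finally show ?thesis
    using int(2)[OF J] by (simp add: power2_eq_square algebra_simps)
qed

section \<open>The function \<open>\<kappa>\<close>\<close>

text \<open>
  At a level \<open>s\<close>, both separation events have the form "one of \<open>Y\<close>, \<open>Y'\<close> lies in
  \<open>{y. F\<^sub>Y y \<le> s}\<close> and the other in its complement". Conditional independence with equal
  conditional distributions gives both the same conditional probability.
\<close>

lemma expectation_cdf_distance_le_third:
  fixes X :: "'a \<Rightarrow> real ^ 'd"
  assumes "prob_space M"
    and Y: "Y \<in> borel_measurable M" and X: "X \<in> borel_measurable M"
    and copy: "cond_iid_copy M Y X N p Y'"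
    and cont: "continuous_on UNIV (dist_fun M Y)"
  shows "(\<integral>\<omega>. \<bar>dist_fun M Y (Y (p \<omega>)) - dist_fun M Y (Y' \<omega>)\<bar> \<partial>N) \<le> 1/3"
proof -
  have N: "prob_space N" and p[measurable]: "p \<in> N \<rightarrow>\<^sub>M M" and distr_p: "distr N M p = M"
    and Y'[measurable]: "Y' \<in> borel_measurable N"
    and indep: "\<And>A B. A \<in> sets borel \<Longrightarrow> B \<in> sets borel \<Longrightarrow> AE \<omega> in N.
        prob_given N (X \<circ> p) {\<omega> \<in> space N. Y (p \<omega>) \<in> A \<and> Y' \<omega> \<in> B} \<omega> =
        prob_given N (X \<circ> p) {\<omega> \<in> space N. Y (p \<omega>) \<in> A} \<omega> *
        prob_given N (X \<circ> p) {\<omega> \<in> space N. Y (p \<omega>) \<in> B} \<omega>"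
    using copy unfolding cond_iid_copy_def prob_extension_def by blast+
  interpret prob_space N by (rule N)
  note [measurable] = Y
  let ?F = "dist_fun M Y" and ?\<mu> = "distr M borel Y"
  interpret \<mu>: real_distribution ?\<mu>
    using Y \<open>prob_space M\<close> by (intro prob_space.real_distribution_distr)
  have [measurable]: "?F \<in> borel_measurable borel"
    by (rule borel_measurable_continuous_onI[OF cont])
  have F01: "?F y \<in> {0..1}" for y
    unfolding dist_fun_def using \<mu>.cdf_nonneg \<mu>.cdf_bounded_prob by auto
  show ?thesis
  proof (rule expectation_abs_diff_le[OF N])
    fix s :: real assume s: "0 < s" "s < 1"
    let ?A = "{y. ?F y \<le> s}" and ?E = "{\<omega> \<in> space N. Y (p \<omega>) \<in> {y. ?F y \<le> s}}"
    have A[measurable]: "?A \<in> sets borel" by measurable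
    have compl: "space N - ?E = {\<omega> \<in> space N. Y (p \<omega>) \<in> - ?A}" by auto
    have "?\<mu> = distr N borel (Y \<circ> p)"
      using distr_distr[OF Y p] distr_p by simp
    then have "measure N ?E = measure ?\<mu> ?A"
      by (simp add: measure_distr vimage_def Int_def conj_commute)
    also have "\<dots> = s"
      using measure_cdf_le_eq[OF \<mu>.real_distribution_axioms _ s] cont by (simp add: dist_fun_def)
    finally have E: "measure N ?E = s" .
    have bound: "measure N J \<le> s * (1 - s)"
      if "J \<in> sets N" "AE \<omega> in N. prob_given N (X \<circ> p) J \<omega>
        = prob_given N (X \<circ> p) ?E \<omega> * prob_given N (X \<circ> p) (space N - ?E) \<omega>" for J
      using prob_le_of_cond_product_compl[OF N _ _ that] measurable_comp[OF p X] E by simp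
    have "measure N {\<omega> \<in> space N. Y (p \<omega>) \<in> ?A \<and> Y' \<omega> \<in> - ?A} \<le> s * (1 - s)"
      by (intro bound indep[of ?A "- ?A", folded compl]) simp_all
    moreover have "measure N {\<omega> \<in> space N. Y (p \<omega>) \<in> - ?A \<and> Y' \<omega> \<in> ?A} \<le> s * (1 - s)"
      by (intro bound indep[of "- ?A" ?A, folded compl, unfolded mult.commute[of "prob_given _ _ (_ - _) _"]])
        simp_all
    ultimately show "measure N {\<omega> \<in> space N. ?F (Y (p \<omega>)) \<le> s \<and> s < ?F (Y' \<omega>)} \<le> s * (1 - s) \<and>
        measure N {\<omega> \<in> space N. ?F (Y' \<omega>) \<le> s \<and> s < ?F (Y (p \<omega>))} \<le> s * (1 - s)"
      by (simp add: not_le conj_commute)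
  qed (use F01 in \<open>auto\<close>)
qed

text \<open>
  The four claims are read off from \<open>\<kappa>(t) = 1 - 3 h(t)\<close> with \<open>h(t) = E(min(D, t))\<close>: they follow
  from pointwise properties of \<open>t \<mapsto> min(D, t)\<close>, apart from the lower bound \<open>\<kappa> \<ge> 0\<close>, which is
  \<open>h(1) = E(D) \<le> 1/3\<close>.
\<close>

theorem lemma2p4:
  fixes M :: "'a measure" and Y :: "'a \<Rightarrow> real" and X :: "'a \<Rightarrow> real ^ 'd"
    and N :: "'b measure" and p :: "'b \<Rightarrow> 'a" and Y' :: "'b \<Rightarrow> real"
  assumes "prob_space M"
    and "Y \<in> borel_measurable M" and "X \<in> borel_measurable M"
    and "cond_iid_copy M Y X N p Y'"
    and "continuous_on UNIV (dist_fun M Y)"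
  shows "kappa M Y N p Y' \<in> {0..1} \<rightarrow> {0..1}
    \<and> convex_on {0..1} (kappa M Y N p Y')
    \<and> antimono_on {0..1} (kappa M Y N p Y')
    \<and> 3-lipschitz_on {0..1} (kappa M Y N p Y')"
proof -
  have N: "prob_space N" and p[measurable]: "p \<in> N \<rightarrow>\<^sub>M M" and Y'[measurable]: "Y' \<in> borel_measurable N"
    using assms(4) unfolding cond_iid_copy_def prob_extension_def by blast+
  interpret prob_space N by (rule N)
  note [measurable] = assms(2)
  have [measurable]: "dist_fun M Y \<in> borel_measurable borel"
    by (rule borel_measurable_continuous_onI[OF assms(5)])
  interpret \<mu>: real_distribution "distr M borel Y"
    using assms(1,2) by (intro prob_space.real_distribution_distr)
  define D where "D \<omega> = \<bar>dist_fun M Y (Y (p \<omega>)) - dist_fun M Y (Y' \<omega>)\<bar>" for \<omega>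
  have [measurable]: "D \<in> borel_measurable N" unfolding D_def by measurable
  have D0: "0 \<le> D \<omega>" for \<omega> by (simp add: D_def)
  have D1: "D \<omega> \<le> 1" for \<omega>
    using \<mu>.cdf_nonneg[of "Y (p \<omega>)"] \<mu>.cdf_nonneg[of "Y' \<omega>"]
      \<mu>.cdf_bounded_prob[of "Y (p \<omega>)"] \<mu>.cdf_bounded_prob[of "Y' \<omega>"]
    unfolding D_def dist_fun_def by linarith
  define h where "h t = (\<integral>\<omega>. min (D \<omega>) t \<partial>N)" for t
  have kappa_eq: "kappa M Y N p Y' t = 1 - 3 * h t" if "0 \<le> t" for t
    using integral_tail_eq_expectation_min[OF N _ D0 that] that
    by (simp add: kappa_def phi_def h_def D_def[symmetric])
  have int: "integrable N (\<lambda>\<omega>. min (D \<omega>) t)" if "0 \<le> t" for t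
    using D0 that by (intro integrable_const_bound[where B=t]) (auto intro!: AE_I2)
  have h_nonneg: "0 \<le> h t" if "0 \<le> t" for t
    using D0 that unfolding h_def by (intro integral_nonneg_AE AE_I2) auto
  have h_mono: "h s \<le> h t" if "0 \<le> s" "s \<le> t" for s t
    unfolding h_def using that by (intro integral_mono int) auto
  have h_third: "h t \<le> 1/3" if "0 \<le> t" "t \<le> 1" for t
  proof -
    have "h t \<le> h 1" using that by (rule h_mono)
    also have "h 1 = (\<integral>\<omega>. D \<omega> \<partial>N)" using D1 by (simp add: h_def)
    also have "\<dots> \<le> 1/3"
      unfolding D_def by (rule expectation_cdf_distance_le_third[OF assms])
    finally show ?thesis .
  qed
  have h_lipschitz: "h t \<le> h s + \<bar>t - s\<bar>" if "0 \<le> s" "0 \<le> t" for s t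
  proof -
    have "h t \<le> (\<integral>\<omega>. min (D \<omega>) s + \<bar>t - s\<bar> \<partial>N)"
      unfolding h_def using that by (intro integral_mono int Bochner_Integration.integrable_add) auto
    also have "\<dots> = h s + \<bar>t - s\<bar>"
      using int[OF that(1)] by (simp add: h_def prob_space)
    finally show ?thesis .
  qed
  have h_concave: "(1 - u) * h x + u * h y \<le> h ((1 - u) * x + u * y)"
    if "0 \<le> x" "0 \<le> y" "0 < u" "u < 1" for u x y
  proof -
    have "(1 - u) * h x + u * h y = (\<integral>\<omega>. (1 - u) * min (D \<omega>) x + u * min (D \<omega>) y \<partial>N)"
      using int that by (simp add: h_def)
    also have "\<dots> \<le> h ((1 - u) * x + u * y)"
      unfolding h_def
    proof (intro integral_mono int Bochner_Integration.integrable_add integrable_mult_right)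
      fix \<omega>
      have "(1 - u) * min (D \<omega>) x + u * min (D \<omega>) y \<le> (1 - u) * D \<omega> + u * D \<omega>"
        using that by (intro add_mono mult_left_mono) auto
      moreover have "(1 - u) * min (D \<omega>) x + u * min (D \<omega>) y \<le> (1 - u) * x + u * y"
        using that by (intro add_mono mult_left_mono) auto
      ultimately show "(1 - u) * min (D \<omega>) x + u * min (D \<omega>) y \<le> min (D \<omega>) ((1 - u) * x + u * y)"
        by (simp add: algebra_simps)
    qed (use that in auto)
    finally show ?thesis .
  qed
  have "kappa M Y N p Y' \<in> {0..1} \<rightarrow> {0..1}"
    using h_nonneg h_third by (force simp: kappa_eq)
  moreover have "convex_on {0..1} (kappa M Y N p Y')"
  proof (rule convex_on_linorderI)
    fix u x y :: real
    assume u: "0 < u" "u < 1" and xy: "x \<in> {0..1}" "y \<in> {0..1}"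
    have "0 \<le> (1 - u) * x + u * y" using u xy by simp
    then show "kappa M Y N p Y' ((1 - u) *\<^sub>R x + u *\<^sub>R y)
        \<le> (1 - u) * kappa M Y N p Y' x + u * kappa M Y N p Y' y"
      using h_concave[of x y u] u xy by (simp add: kappa_eq algebra_simps)
  qed simp
  moreover have "antimono_on {0..1} (kappa M Y N p Y')"
    using h_mono by (intro monotone_onI) (simp add: kappa_eq)
  moreover have "3-lipschitz_on {0..1} (kappa M Y N p Y')"
  proof (rule lipschitz_onI)
    fix s t :: real assume st: "s \<in> {0..1}" "t \<in> {0..1}"
    then show "dist (kappa M Y N p Y' s) (kappa M Y N p Y' t) \<le> 3 * dist s t"
      using h_lipschitz[of s t] h_lipschitz[of t s] by (auto simp: kappa_eq dist_real_def abs_if split: if_splits)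
  qed simp
  ultimately show ?thesis by blast
qed

end
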